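(* There exists a deterministic one-round algorithm for $\textsc{List}(K_3)$ under edge insertions and node insertions with bandwidth $O(\Delta \log \log \log n)$, where $\Delta$ is the maximum degree of the dynamic network.
   Context: Dynamic network model: a dynamic network is a sequence of graphs $G^0, G^1, \ldots$ with $n$ nodes in total, where each $G^i$ ($i \ge 1$) is either identical to $G^{i-1}$ or obtained from it by a single topological change; here both edge insertions and node insertions are allowed (a node insertion adds a new node adjacent to an arbitrary subset of existing nodes). Nodes have distinct identifiers from $[n]$, each node knows the identifiers of its current neighbors, and every node initially knows the entire topology of $G^0$. Communication is synchronous: in each round the topological change (if any) happens first, then each node may send a $B$-bit message to each of its current neighbors; $B$ is the bandwidth. A node learns of changes only by comparing its neighbor list between consecutive rounds. A one-round algorithm must, after each round's topological change and that round's communication, output correctly for the current graph. $\textsc{List}(H)$: every subgraph of the current graph isomorphic to $H$ must be listed (by node identifiers) by at least one node of the network. $K_3$ is the triangle. $\Delta$ is the maximum degree over all graphs in the dynamic network. *)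

theory Defs
  imports Complex_Main "HOL-Library.Landau_Symbols"
begin

record sgraph =
  verts :: "nat set"
  edges :: "nat set set"

definition simple_graph :: "sgraph \<Rightarrow> bool" where
  "simple_graph G \<longleftrightarrow> finite (verts G) \<and>
     (\<forall>e\<in>edges G. \<exists>u\<in>verts G. \<exists>v\<in>verts G. u \<noteq> v \<and> e = {u, v})"

definition neighbors :: "sgraph \<Rightarrow> nat \<Rightarrow> nat set" where
  "neighbors G v = {u. u \<noteq> v \<and> {u, v} \<in> edges G}"

definition complete_graph :: "nat \<Rightarrow> sgraph" where
  "complete_graph k =
     \<lparr>verts = {1..k}, edges = {{u, v} | u v. u \<in> {1..k} \<and> v \<in> {1..k} \<and> u \<noteq> v}\<rparr>"

definition isomorphic :: "sgraph \<Rightarrow> sgraph \<Rightarrow> bool" where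
  "isomorphic H S \<longleftrightarrow>
     (\<exists>f. bij_betw f (verts H) (verts S) \<and> edges S = (\<lambda>e. f ` e) ` edges H)"

definition subgraph :: "sgraph \<Rightarrow> sgraph \<Rightarrow> bool" where
  "subgraph S G \<longleftrightarrow> simple_graph S \<and> verts S \<subseteq> verts G \<and> edges S \<subseteq> edges G"

definition copies :: "sgraph \<Rightarrow> sgraph \<Rightarrow> sgraph set" where
  "copies H G = {S. subgraph S G \<and> isomorphic H S}"


definition edge_insertion :: "sgraph \<Rightarrow> sgraph \<Rightarrow> bool" where
  "edge_insertion G G' \<longleftrightarrow>
     (\<exists>u\<in>verts G. \<exists>v\<in>verts G. u \<noteq> v \<and> {u, v} \<notin> edges G \<and>
        G' = \<lparr>verts = verts G, edges = insert {u, v} (edges G)\<rparr>)"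

definition node_insertion :: "sgraph \<Rightarrow> sgraph \<Rightarrow> bool" where
  "node_insertion G G' \<longleftrightarrow>
     (\<exists>x S. x \<notin> verts G \<and> S \<subseteq> verts G \<and>
        G' = \<lparr>verts = insert x (verts G), edges = edges G \<union> {{x, u} | u. u \<in> S}\<rparr>)"

text \<open>Identifiers are drawn from \<open>{1..n}\<close>; those outside \<open>verts (G i)\<close> belong to nodes
  that are not (yet) present. A finite run is covered by repeating its last graph.\<close>

definition dynamic_network :: "nat \<Rightarrow> (nat \<Rightarrow> sgraph) \<Rightarrow> bool" where
  "dynamic_network n G \<longleftrightarrow> simple_graph (G 0) \<and>
     (\<forall>i. verts (G i) \<subseteq> {1..n}) \<and>
     (\<forall>i. G (Suc i) = G i \<or> edge_insertion (G i) (G (Suc i)) \<or>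
          node_insertion (G i) (G (Suc i)))"

text \<open>In a dynamic network the set below is finite, so \<open>Sup\<close> on \<open>nat\<close> is its maximum
  (and 0 if there are no nodes at all).\<close>

definition max_degree :: "(nat \<Rightarrow> sgraph) \<Rightarrow> nat" where
  "max_degree G = Sup {card (neighbors (G i) v) | i v. v \<in> verts (G i)}"


text \<open>What a node observes in one round: its neighbor set after the topological change, and
  the message received from each neighbor. The empty message stands for silence.\<close>

type_synonym observation = "nat set \<times> (nat \<Rightarrow> bool list)"

text \<open>Nodes remember everything, so instead of carrying an explicit state type an algorithm
  is a pair of functions of a node's complete local view. Both take \<open>n\<close>, the node's own
  identifier, the initial graph (known to later-inserted nodes as well), and the node's observations in the rounds it has completed
  (oldest first). \<open>send\<close> additionally takes the neighbor set of the round in progress and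
  the recipient; \<open>listing\<close> is evaluated at the end of the round. The maximum degree of the
  dynamic network is not among the inputs.\<close>

record algorithm =
  send :: "nat \<Rightarrow> nat \<Rightarrow> sgraph \<Rightarrow> observation list \<Rightarrow> nat set \<Rightarrow> nat \<Rightarrow> bool list"
  listing :: "nat \<Rightarrow> nat \<Rightarrow> sgraph \<Rightarrow> observation list \<Rightarrow> sgraph set"

text \<open>\<open>history A n G i v\<close> lists the observations of \<open>v\<close> in rounds \<open>1..i\<close>. Recording starts
  in the round in which \<open>v\<close> is inserted; it is empty while \<open>v\<close> is absent.\<close>

fun history :: "algorithm \<Rightarrow> nat \<Rightarrow> (nat \<Rightarrow> sgraph) \<Rightarrow> nat \<Rightarrow> nat \<Rightarrow> observation list" where
  "history A n G 0 v = []"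
| "history A n G (Suc i) v =
     (if v \<in> verts (G (Suc i)) then
        history A n G i v @
          [(neighbors (G (Suc i)) v,
            \<lambda>u. if u \<in> neighbors (G (Suc i)) v
                then send A n u (G 0) (history A n G i u) (neighbors (G (Suc i)) u) v
                else [])]
      else [])"

text \<open>Rounds are numbered from 1; round \<open>Suc i\<close> communicates over \<open>G (Suc i)\<close>.\<close>

definition message ::
    "algorithm \<Rightarrow> nat \<Rightarrow> (nat \<Rightarrow> sgraph) \<Rightarrow> nat \<Rightarrow> nat \<Rightarrow> nat \<Rightarrow> bool list" where
  "message A n G i u v = send A n u (G 0) (history A n G i u) (neighbors (G (Suc i)) u) v"

definition within_bandwidth :: "algorithm \<Rightarrow> nat \<Rightarrow> (nat \<Rightarrow> sgraph) \<Rightarrow> nat \<Rightarrow> bool" where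
  "within_bandwidth A n G B \<longleftrightarrow>
     (\<forall>i. \<forall>u\<in>verts (G (Suc i)). \<forall>v\<in>neighbors (G (Suc i)) u. length (message A n G i u v) \<le> B)"

text \<open>The equation demands both that every copy is listed by some node and that no node ever
  lists something which is not a copy in the current graph.\<close>

definition lists_in_one_round :: "sgraph \<Rightarrow> algorithm \<Rightarrow> nat \<Rightarrow> (nat \<Rightarrow> sgraph) \<Rightarrow> bool" where
  "lists_in_one_round H A n G \<longleftrightarrow>
     (\<forall>i. (\<Union>v\<in>verts (G (Suc i)). listing A n v (G 0) (history A n G (Suc i) v)) =
          copies H (G (Suc i)))"

end

theory Submission
  imports Defs "HOL-Library.Sublist" "HOL-Real_Asymp.Real_Asymp"
begin

text \<open>
  Let an edge \<open>{u, v}\<close> be inserted whose ends have a common neighbor \<open>w\<close>. Node \<open>w\<close> hears from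
  \<open>u\<close> and \<open>v\<close> that both got a new neighbor, but it has to rule out that a new node adjacent to both
  was inserted. Let \<open>q\<close> be a position in which the identifiers of \<open>u\<close> and \<open>v\<close> differ: the
  identifier of a common new neighbor agrees with that of \<open>u\<close> or that of \<open>v\<close> at \<open>q\<close>, so if both
  know \<open>q\<close>, then one bit from each of them settles the question. The position has
  \<open>O(log log n)\<close> bits, and \<open>w\<close> sends it to both, one bit per round and pair of neighbors, as soon
  as \<open>w\<close> is adjacent to \<open>u\<close> and \<open>v\<close>.

  If there was not enough time for this, then one of the edges at \<open>w\<close>, say \<open>{v, w}\<close>, is only
  \<open>O(log log n)\<close> rounds old, and its age can be communicated with \<open>O(log log log n)\<close> bits. Each node
  reports to its neighbors the ages of its recent edges, together with the kind of change which
  created them. As there is a single change per round, \<open>u\<close> recognizes the edge \<open>{v, w}\<close> from the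
  reports of \<open>v\<close> and \<open>w\<close>. Triangles created by a node insertion are recognized in the same way, as
  the new node reports its own birth.
\<close>

subsection \<open>Coding messages as bit strings\<close>

definition bit_length :: "nat \<Rightarrow> nat" where
  "bit_length m = nat \<lceil>log 2 (real m + 1)\<rceil>"

lemma less_two_power_bit_length: "m < 2 ^ bit_length m"
proof -
  have "log 2 (real m + 1) \<le> real (bit_length m)"
    unfolding bit_length_def by linarith
  then have "real m + 1 \<le> 2 powr real (bit_length m)"
    by (simp add: log_le_iff)
  then have "real m + 1 \<le> real (2 ^ bit_length m)"
    by (simp add: powr_realpow)
  then show ?thesis by linarith
qed

lemma bit_length_le: "real (bit_length m) \<le> log 2 (real m + 1) + 1"
proof -
  have "0 \<le> log 2 (real m + 1)" by simp
  then show ?thesis unfolding bit_length_def by linarith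
qed

lemma not_bit_if_less_two_power:
  assumes "(m::nat) < 2 ^ k" "k \<le> j" shows "\<not> bit m j"
  using assms by (metis bit_take_bit_iff linorder_not_less take_bit_nat_eq_self)

lemma eq_if_bits_eq:
  assumes "(x::nat) < 2 ^ k" "y < 2 ^ k" "\<And>j. j < k \<Longrightarrow> bit x j = bit y j"
  shows "x = y"
proof (rule bit_eqI)
  fix j show "bit x j = bit y j"
    using assms not_bit_if_less_two_power by (cases "j < k") (metis, metis linorder_not_less)
qed

definition separator :: "nat \<Rightarrow> nat \<Rightarrow> nat" where
  "separator x y = (LEAST q. bit x q \<noteq> bit y q)"

lemma separator_commute: "separator x y = separator y x"
  unfolding separator_def by (metis (no_types))

lemma bit_separator:
  assumes "x \<noteq> y" shows "bit x (separator x y) \<noteq> bit y (separator x y)"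
proof -
  have "\<exists>q. bit x q \<noteq> bit y q" using assms bit_eqI by blast
  then show ?thesis unfolding separator_def by (rule LeastI_ex)
qed

lemma separator_less:
  assumes "x \<noteq> y" "x < 2 ^ k" "y < 2 ^ k" shows "separator x y < k"
  using bit_separator[OF assms(1)] not_bit_if_less_two_power assms(2,3)
  by (metis linorder_not_less)

text \<open>All entries have the same width, so a message needs no delimiters and silence is the
  code of the empty list.\<close>

definition encode :: "nat \<Rightarrow> nat list \<Rightarrow> bool list" where
  "encode W ms = concat (map (\<lambda>m. map (bit m) [0..<W]) ms)"

definition decode :: "nat \<Rightarrow> bool list \<Rightarrow> nat list" where
  "decode W = inv_into {ms. \<forall>m\<in>set ms. m < 2 ^ W} (encode W)"

lemma length_encode: "length (encode W ms) = W * length ms"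
  by (induction ms) (auto simp: encode_def)

lemma decode_encode:
  assumes "W > 0" "\<forall>m\<in>set ms. m < 2 ^ W" shows "decode W (encode W ms) = ms"
proof -
  have "inj_on (encode W) {ms. \<forall>m\<in>set ms. m < 2 ^ W}"
  proof (rule inj_onI)
    fix xs ys assume xy: "xs \<in> {ms. \<forall>m\<in>set ms. m < 2 ^ W}" "ys \<in> {ms. \<forall>m\<in>set ms. m < 2 ^ W}"
      and eq: "encode W xs = encode W ys"
    let ?f = "\<lambda>m::nat. map (bit m) [0..<W]"
    \<comment> \<open>Positive width lets the length of a code determine the number of
      entries.\<close>
    have len: "length xs = length ys"
      using arg_cong[OF eq, of length] \<open>W > 0\<close> by (simp add: length_encode)
    have "map ?f xs = map ?f ys"
      by (rule concat_injective) (use eq len in \<open>auto simp: encode_def set_zip\<close>)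
    moreover have "inj_on ?f (set xs \<union> set ys)"
      by (rule inj_onI) (use xy in \<open>auto intro!: eq_if_bits_eq[of _ W]\<close>)
    ultimately show "xs = ys" using inj_on_map_eq_map by blast
  qed
  then show ?thesis unfolding decode_def using assms(2) by (simp add: inv_into_f_f)
qed

lemma decode_Nil: "W > 0 \<Longrightarrow> decode W [] = []"
  using decode_encode[of W "[]"] by (simp add: encode_def)

section \<open>Six lists in one message, tagged by residues modulo 6\<close>

definition on_channel :: "nat \<Rightarrow> nat list \<Rightarrow> nat list" where
  "on_channel c xs = map (\<lambda>x. 6 * x + c) xs"

definition channel :: "nat \<Rightarrow> nat list \<Rightarrow> nat list" where
  "channel c ms = map (\<lambda>m. m div 6) (filter (\<lambda>m. m mod 6 = c) ms)"

lemma channel_append [simp]: "channel c (xs @ ys) = channel c xs @ channel c ys"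
  by (simp add: channel_def)

lemma channel_Nil [simp]: "channel c [] = []"
  by (simp add: channel_def)

lemma channel_on_channel [simp]:
  assumes "d < 6" shows "channel c (on_channel d xs) = (if c = d then xs else [])"
  using assms by (induction xs) (auto simp: channel_def on_channel_def)

lemma length_on_channel [simp]: "length (on_channel c xs) = length xs"
  by (simp add: on_channel_def)


subsection \<open>The algorithm\<close>

definition id_bits :: "nat \<Rightarrow> nat" where "id_bits n = bit_length n"
text \<open>Enough bits to write a position below \<open>id_bits n\<close>. The successor keeps it
  positive, as it serves as a modulus.\<close>

definition window :: "nat \<Rightarrow> nat" where "window n = Suc (bit_length (id_bits n))"
text \<open>An entry is at most \<open>window n\<close> before it is tagged with one of six
  channels, hence below \<open>6 * window n + 6\<close>.\<close>

definition width :: "nat \<Rightarrow> nat" where "width n = Suc (bit_length (6 * window n + 6))"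

text \<open>Past rounds are addressed by their age: age 0 is the latest round in the history \<open>h\<close>.\<close>

definition nbrs_at :: "sgraph \<Rightarrow> nat \<Rightarrow> observation list \<Rightarrow> nat \<Rightarrow> nat set" where
  "nbrs_at G0 v h a = (if a < length h then fst (rev h ! a) else neighbors G0 v)"

definition received_at :: "nat \<Rightarrow> observation list \<Rightarrow> nat \<Rightarrow> nat \<Rightarrow> nat list" where
  "received_at n h a u = (if a < length h then decode (width n) (snd (rev h ! a) u) else [])"

definition new_at :: "sgraph \<Rightarrow> nat \<Rightarrow> observation list \<Rightarrow> nat \<Rightarrow> nat set" where
  "new_at G0 v h a = nbrs_at G0 v h a - nbrs_at G0 v h (Suc a)"

definition born_at :: "sgraph \<Rightarrow> nat \<Rightarrow> observation list \<Rightarrow> nat \<Rightarrow> bool" where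
  "born_at G0 v h a \<longleftrightarrow> v \<notin> verts G0 \<and> Suc a = length h"

text \<open>In order of arrival, so that a neighbor keeps its position for ever.\<close>

definition arrivals :: "sgraph \<Rightarrow> nat \<Rightarrow> observation list \<Rightarrow> nat list" where
  "arrivals G0 v h =
     fold (\<lambda>N xs. xs @ sorted_list_of_set (N - set xs)) (map fst h)
       (sorted_list_of_set (neighbors G0 v))"

definition active_ages :: "nat \<Rightarrow> sgraph \<Rightarrow> nat \<Rightarrow> observation list \<Rightarrow> nat list" where
  "active_ages n G0 v h = filter (\<lambda>a. new_at G0 v h a \<noteq> {}) [0..<Suc (window n)]"

text \<open>Whether a new neighbor was itself just born is only known after its first message,
  hence never at age 0.\<close>

definition edge_inserted_at :: "nat \<Rightarrow> sgraph \<Rightarrow> nat \<Rightarrow> observation list \<Rightarrow> nat \<Rightarrow> bool" where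
  "edge_inserted_at n G0 v h a \<longleftrightarrow>
     a > 0 \<and> (\<forall>y\<in>new_at G0 v h a. 0 \<notin> set (channel 2 (received_at n h a y)))"

text \<open>The node \<open>v\<close> need not know which neighbor of \<open>w\<close> the position
  \<open>p\<close> stands for: the bits received for \<open>p\<close> reveal \<open>q\<close>, and
  comparing \<open>q\<close> with its own new neighbors is all that is asked. Ages start at 1
  because the messages of the current round have not arrived yet.\<close>

definition reply :: "nat \<Rightarrow> sgraph \<Rightarrow> nat \<Rightarrow> observation list \<Rightarrow> nat \<Rightarrow> nat \<Rightarrow> bool" where
  "reply n G0 v h w p \<longleftrightarrow> new_at G0 v h 0 \<noteq> {} \<and>
     (\<exists>q<id_bits n.
        (\<forall>a\<in>{1..window n}.
           (channel 4 (received_at n h a w) ! p = 1) = bit q (hd (channel 0 (received_at n h a w)))) \<and>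
        (\<forall>z\<in>new_at G0 v h 0. bit z q \<noteq> bit v q))"

text \<open>Channel 0 carries the index of the bit transmitted on channel 4. Channels 1, 2 and 3 carry
  the ages at which the sender got new neighbors by an edge insertion, by its own birth, and in
  another or a not yet known way. Channel 5 answers the bits received on channel 4 so far.\<close>

definition message_body :: "nat \<Rightarrow> sgraph \<Rightarrow> nat \<Rightarrow> observation list \<Rightarrow> nat \<Rightarrow> nat list" where
  "message_body n G0 v h u =
     on_channel 0 [length h mod window n] @
     on_channel 1 (filter (\<lambda>a. \<not> born_at G0 v h a \<and> edge_inserted_at n G0 v h a) (active_ages n G0 v h)) @
     on_channel 2 (filter (born_at G0 v h) (active_ages n G0 v h)) @
     on_channel 3 (filter (\<lambda>a. \<not> born_at G0 v h a \<and> \<not> edge_inserted_at n G0 v h a) (active_ages n G0 v h)) @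
     on_channel 4 (map (\<lambda>z. of_bool (bit (separator u z) (length h mod window n))) (arrivals G0 v h)) @
     on_channel 5 (map (\<lambda>p. of_bool (reply n G0 v h u p)) [0..<length (channel 4 (received_at n h 1 u))])"

definition triangle :: "nat \<Rightarrow> nat \<Rightarrow> nat \<Rightarrow> sgraph" where
  "triangle x y z = \<lparr>verts = {x, y, z}, edges = {{x, y}, {x, z}, {y, z}}\<rparr>"

text \<open>Channel 3 is not accepted from \<open>x\<close>: two neighbors of a newly inserted node
  gain a neighbor in the same round without being adjacent. Once the kind of change is known from
  \<open>x\<close>, only the round matters for \<open>y\<close>.\<close>

definition simultaneous :: "nat \<Rightarrow> observation list \<Rightarrow> nat \<Rightarrow> nat \<Rightarrow> bool" where
  "simultaneous n h x y \<longleftrightarrow>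
     (\<exists>a. a \<in> set (channel 1 (received_at n h 0 x)) \<union> set (channel 2 (received_at n h 0 x)) \<and>
          a \<in> set (channel 1 (received_at n h 0 y)) \<union> set (channel 2 (received_at n h 0 y)) \<union>
              set (channel 3 (received_at n h 0 y)))"

definition confirms :: "nat \<Rightarrow> sgraph \<Rightarrow> nat \<Rightarrow> observation list \<Rightarrow> nat \<Rightarrow> nat \<Rightarrow> bool" where
  "confirms n G0 v h x y \<longleftrightarrow>
     (\<exists>p<length (arrivals G0 v h). arrivals G0 v h ! p = y \<and>
        channel 5 (received_at n h 0 x) ! p = 1)"

definition detects :: "nat \<Rightarrow> sgraph \<Rightarrow> nat \<Rightarrow> observation list \<Rightarrow> nat \<Rightarrow> nat \<Rightarrow> bool" where
  "detects n G0 v h x y \<longleftrightarrow>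
     {x, y} \<in> edges G0 \<or> simultaneous n h x y \<or>
     window n < length h \<and> (\<forall>a\<le>window n. {x, y} \<subseteq> nbrs_at G0 v h a) \<and>
       confirms n G0 v h x y \<and> confirms n G0 v h y x"

definition list_now :: "nat \<Rightarrow> nat \<Rightarrow> sgraph \<Rightarrow> observation list \<Rightarrow> sgraph set" where
  "list_now n v G0 h =
     {triangle v x y | x y. {x, y} \<subseteq> nbrs_at G0 v h 0 \<and> x \<noteq> y \<and> detects n G0 v h x y}"

text \<open>The appended pair is the round in progress: neighbors known, messages not yet. Nothing
  is ever deleted, so whatever was listed at a prefix of the history may be listed for ever.\<close>

definition triangle_algorithm :: algorithm where
  "triangle_algorithm =
     \<lparr>send = (\<lambda>n v G0 h N u. encode (width n) (message_body n G0 v (h @ [(N, \<lambda>_. [])]) u)),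
      listing = (\<lambda>n v G0 h. \<Union>h'\<in>{h'. prefix h' h}. list_now n v G0 h')\<rparr>"


section \<open>Elementary properties of the algorithm\<close>

lemma send_triangle_algorithm:
  "send triangle_algorithm n v G0 h N u =
     encode (width n) (message_body n G0 v (h @ [(N, \<lambda>_. [])]) u)"
  by (simp add: triangle_algorithm_def)

lemma listing_triangle_algorithm:
  "listing triangle_algorithm n v G0 h = (\<Union>h'\<in>{h'. prefix h' h}. list_now n v G0 h')"
  by (simp add: triangle_algorithm_def)

lemma width_pos: "width n > 0" by (simp add: width_def)
lemma window_pos: "window n > 0" by (simp add: window_def)

lemma decode_message:
  "decode (width n) (encode (width n) (message_body n G0 v h u)) = message_body n G0 v h u"
proof (rule decode_encode[OF width_pos], rule ballI)
  fix m assume "m \<in> set (message_body n G0 v h u)"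
  moreover have k: "length h mod window n < window n" by (simp add: window_pos)
  moreover have "1 \<le> window n" using window_pos[of n] by simp
  ultimately have "m < 6 * window n + 6"
    by (auto simp: message_body_def on_channel_def active_ages_def less_Suc_eq_le
        simp del: upt_Suc) (use k in linarith)
  also have "\<dots> < 2 ^ width n"
    using less_two_power_bit_length[of "6 * window n + 6"] by (simp add: width_def)
  finally show "m < 2 ^ width n" .
qed

lemma nbrs_at_cong:
  assumes "map fst h = map fst h'" shows "nbrs_at G0 v h = nbrs_at G0 v h'"
proof -
  have l: "length h = length h'" using assms by (metis length_map)
  have "fst (rev h ! a) = fst (rev h' ! a)" if "a < length h" for a
    using arg_cong[OF assms, of "\<lambda>xs. rev xs ! a"] that l by (simp add: rev_map)
  then show ?thesis using l by (auto simp: nbrs_at_def fun_eq_iff)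
qed

lemma arrivals_snoc:
  "arrivals G0 v (h @ [ob]) = arrivals G0 v h @ sorted_list_of_set (fst ob - set (arrivals G0 v h))"
  by (simp add: arrivals_def)

lemma distinct_arrivals: "distinct (arrivals G0 v h)"
proof (induction h rule: rev_induct)
  case (snoc ob h)
  show ?case
    by (cases "finite (fst ob - set (arrivals G0 v h))") (use snoc in \<open>auto simp: arrivals_snoc\<close>)
qed (simp add: arrivals_def)


subsection \<open>Topological changes\<close>

locale network =
  fixes n :: nat and G :: "nat \<Rightarrow> sgraph"
  assumes dyn: "dynamic_network n G"
begin

definition newn :: "nat \<Rightarrow> nat \<Rightarrow> nat set" where
  "newn i v = neighbors (G (Suc i)) v - neighbors (G i) v"

definition born :: "nat \<Rightarrow> nat \<Rightarrow> bool" where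
  "born i v \<longleftrightarrow> v \<in> verts (G (Suc i)) \<and> v \<notin> verts (G i)"

lemma step: "G (Suc i) = G i \<or> edge_insertion (G i) (G (Suc i)) \<or> node_insertion (G i) (G (Suc i))"
  using dyn by (simp add: dynamic_network_def)

lemma simple: "simple_graph (G i)"
proof (induction i)
  case 0 show ?case using dyn by (simp add: dynamic_network_def)
next
  case (Suc i)
  show ?case using step[of i]
  proof (elim disjE)
    assume "edge_insertion (G i) (G (Suc i))"
    then show ?thesis using Suc unfolding edge_insertion_def simple_graph_def by fastforce
  next
    assume "node_insertion (G i) (G (Suc i))"
    then obtain x S where "x \<notin> verts (G i)" "S \<subseteq> verts (G i)"
      "G (Suc i) = \<lparr>verts = insert x (verts (G i)), edges = edges (G i) \<union> {{x, u} | u. u \<in> S}\<rparr>"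
      by (auto simp: node_insertion_def)
    then show ?thesis using Suc unfolding simple_graph_def
      by simp (smt (verit) Un_iff insertI1 insert_iff mem_Collect_eq subsetD)
  qed (use Suc in simp)
qed

lemma verts_le: "verts (G i) \<subseteq> {1..n}"
  using dyn by (simp add: dynamic_network_def)

lemma mono_step: "verts (G i) \<subseteq> verts (G (Suc i)) \<and> edges (G i) \<subseteq> edges (G (Suc i))"
  using step[of i] by (auto simp: edge_insertion_def node_insertion_def)

lemma verts_mono: "i \<le> j \<Longrightarrow> verts (G i) \<subseteq> verts (G j)"
  by (rule lift_Suc_mono_le[of "\<lambda>i. verts (G i)"]) (use mono_step in auto)

lemma edges_mono: "i \<le> j \<Longrightarrow> edges (G i) \<subseteq> edges (G j)"
  by (rule lift_Suc_mono_le[of "\<lambda>i. edges (G i)"]) (use mono_step in auto)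

lemma neighbors_mono: "i \<le> j \<Longrightarrow> neighbors (G i) v \<subseteq> neighbors (G j) v"
  using edges_mono by (auto simp: neighbors_def)

lemma edge_verts: "{u, v} \<in> edges (G i) \<Longrightarrow> u \<in> verts (G i) \<and> v \<in> verts (G i) \<and> u \<noteq> v"
  using simple[of i] unfolding simple_graph_def by (metis doubleton_eq_iff)

lemma neighbors_iff: "u \<in> neighbors (G i) v \<longleftrightarrow> {u, v} \<in> edges (G i)"
  using edge_verts[of u v i] by (auto simp: neighbors_def)

lemma neighbors_sym: "u \<in> neighbors (G i) v \<longleftrightarrow> v \<in> neighbors (G i) u"
  by (simp add: neighbors_iff insert_commute)

lemma neighbors_verts: "u \<in> neighbors (G i) v \<Longrightarrow> u \<in> verts (G i) \<and> v \<in> verts (G i)"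
  using edge_verts neighbors_iff by blast

lemma neighbors_subset: "neighbors (G i) v \<subseteq> {1..n}"
  using neighbors_verts verts_le by blast

lemma finite_neighbors [simp]: "finite (neighbors (G i) v)"
  using neighbors_subset finite_subset by blast

text \<open>Reduces a round to the shape of its new adjacencies: none, a single edge, or a possibly
  empty star around the newborn node. The adjacency lemmas that follow are read off from it.\<close>

lemma newn_cases:
  obtains (none) "\<And>v. newn i v = {}" "\<And>v. \<not> born i v"
  | (edge) u v where "u \<noteq> v" "\<And>z. newn i z = (if z = u then {v} else if z = v then {u} else {})"
      "\<And>v. \<not> born i v"
  | (node) x S where "x \<notin> S" "newn i x = S" "\<And>z. z \<noteq> x \<Longrightarrow> newn i z = (if z \<in> S then {x} else {})"
      "\<And>v. born i v \<longleftrightarrow> v = x"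
  using step[of i]
proof (elim disjE)
  assume "G (Suc i) = G i"
  then show ?thesis by (intro none) (auto simp: newn_def born_def)
next
  assume "edge_insertion (G i) (G (Suc i))"
  then obtain u v where uv: "u \<in> verts (G i)" "v \<in> verts (G i)" "u \<noteq> v" "{u, v} \<notin> edges (G i)"
    "G (Suc i) = \<lparr>verts = verts (G i), edges = insert {u, v} (edges (G i))\<rparr>"
    unfolding edge_insertion_def by blast
  show ?thesis
  proof (rule edge)
    show "u \<noteq> v" by fact
    show "newn i z = (if z = u then {v} else if z = v then {u} else {})" for z
      using uv by (auto simp: newn_def neighbors_def doubleton_eq_iff insert_commute)
    show "\<not> born i v" for v using uv by (simp add: born_def)
  qed
next
  assume "node_insertion (G i) (G (Suc i))"
  then obtain x S where xS: "x \<notin> verts (G i)" "S \<subseteq> verts (G i)"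
    "G (Suc i) = \<lparr>verts = insert x (verts (G i)), edges = edges (G i) \<union> {{x, u} | u. u \<in> S}\<rparr>"
    unfolding node_insertion_def by blast
  have ne: "{x, u} \<notin> edges (G i)" "{u, x} \<notin> edges (G i)" for u using edge_verts xS(1) by blast+
  show ?thesis
  proof (rule node)
    show "x \<notin> S" using xS by blast
    then show "newn i x = S" using xS ne by (auto simp: newn_def neighbors_def doubleton_eq_iff)
    show "newn i z = (if z \<in> S then {x} else {})" if "z \<noteq> x" for z
      using xS ne that \<open>x \<notin> S\<close> by (auto simp: newn_def neighbors_def doubleton_eq_iff)
    show "born i v \<longleftrightarrow> v = x" for v using xS by (auto simp: born_def)
  qed
qed

lemma born_newn_adjacent:
  assumes "born i u" "newn i v \<noteq> {}" "u \<noteq> v" shows "u \<in> newn i v"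
  using assms by (cases rule: newn_cases[of i]) (auto split: if_splits)

lemma edge_newn_adjacent:
  assumes "newn i u \<noteq> {}" "\<not> born i u" "\<forall>y\<in>newn i u. \<not> born i y" "newn i v \<noteq> {}" "u \<noteq> v"
  shows "u \<in> newn i v"
  using assms by (cases rule: newn_cases[of i]) (auto split: if_splits)

text \<open>Old nodes gaining neighbors in one round are the ends of an inserted edge or share the
  newborn neighbor. The separating bits will rule out the latter.\<close>

lemma newn_same_or_adjacent:
  assumes "\<not> born i u" "\<not> born i v" "y \<in> newn i u" "z \<in> newn i v" "u \<noteq> v"
  shows "y = z \<or> u \<in> newn i v"
  using assms by (cases rule: newn_cases[of i]) (auto split: if_splits)

lemma newn_edge:
  assumes "u \<in> newn i v" "\<not> born i u" "\<not> born i v"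
  shows "newn i u = {v}"
  using assms by (cases rule: newn_cases[of i]) (auto split: if_splits)

lemma newn_sym: "u \<in> newn i v \<longleftrightarrow> v \<in> newn i u"
  by (simp add: newn_def neighbors_sym[of u])

lemma newn_edges: "u \<in> newn i v \<Longrightarrow> Suc i \<le> t \<Longrightarrow> {u, v} \<in> edges (G t)"
  using edges_mono[of "Suc i" t] by (auto simp: newn_def neighbors_iff)


subsection \<open>Histories\<close>

abbreviation hist :: "nat \<Rightarrow> nat \<Rightarrow> observation list" where
  "hist \<equiv> history triangle_algorithm n G"

text \<open>What a node knows when it sends its messages in round \<open>Suc i\<close>.\<close>

definition pre :: "nat \<Rightarrow> nat \<Rightarrow> observation list" where
  "pre i v = hist i v @ [(neighbors (G (Suc i)) v, \<lambda>_. [])]"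

definition obs :: "nat \<Rightarrow> nat \<Rightarrow> observation" where
  "obs i v = (neighbors (G (Suc i)) v,
     \<lambda>u. if u \<in> neighbors (G (Suc i)) v
         then encode (width n) (message_body n (G 0) u (pre i u) v) else [])"

lemma hist_Suc:
  "hist (Suc i) v = (if v \<in> verts (G (Suc i)) then hist i v @ [obs i v] else [])"
  by (simp add: obs_def pre_def send_triangle_algorithm cong: if_cong)

lemma hist_Suc_present: "v \<in> verts (G (Suc i)) \<Longrightarrow> hist (Suc i) v = hist i v @ [obs i v]"
  unfolding hist_Suc by simp

declare history.simps(2) [simp del]

text \<open>Nodes never leave, so the recorded rounds are the latest ones; age \<open>a\<close> at
  time \<open>t\<close> is round \<open>t - a\<close>.\<close>

lemma age_less_length_hist:
  "a < length (hist t v) \<longleftrightarrow> a < t \<and> v \<in> verts (G (t - a))"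
proof (induction t arbitrary: a)
  case (Suc t)
  show ?case
  proof (cases "v \<in> verts (G (Suc t))")
    case True
    then show ?thesis using Suc by (cases a) (auto simp: hist_Suc_present)
  next
    case False
    moreover have "v \<notin> verts (G (Suc t - a))" using False verts_mono[of "Suc t - a" "Suc t"] by auto
    ultimately show ?thesis by (simp add: hist_Suc)
  qed
qed simp

lemma rev_hist_nth:
  assumes "a < length (hist t v)" shows "rev (hist t v) ! a = obs (t - Suc a) v"
  using assms
proof (induction t arbitrary: a)
  case (Suc t)
  then have "v \<in> verts (G (Suc t))" by (auto simp: hist_Suc split: if_splits)
  then show ?case using Suc by (cases a) (auto simp: hist_Suc_present)
qed simp

text \<open>For ages beyond the first round, truncated subtraction yields \<open>G 0\<close>, as
  does the default of \<open>nbrs_at\<close>; for rounds before the insertion of \<open>v\<close>,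
  both sides are empty.\<close>

lemma nbrs_at_hist: "nbrs_at (G 0) v (hist t v) a = neighbors (G (t - a)) v"
proof (cases "a < length (hist t v)")
  case True
  then have "a < t" using age_less_length_hist by blast
  then have "Suc (t - Suc a) = t - a" by simp
  then show ?thesis using True by (simp add: nbrs_at_def rev_hist_nth obs_def)
next
  case False
  show ?thesis
  proof (cases "a < t")
    case True
    then have "v \<notin> verts (G (t - a))" "v \<notin> verts (G 0)"
      using False age_less_length_hist[of a t v] verts_mono[of 0 "t - a"] by auto
    then have "neighbors (G (t - a)) v = {}" "neighbors (G 0) v = {}" using neighbors_verts by blast+
    then show ?thesis using False by (simp add: nbrs_at_def)
  qed (use False in \<open>simp add: nbrs_at_def\<close>)
qed

lemma map_fst_pre: "v \<in> verts (G (Suc i)) \<Longrightarrow> map fst (pre i v) = map fst (hist (Suc i) v)"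
  by (simp add: pre_def hist_Suc_present obs_def)

lemma length_pre: "v \<in> verts (G (Suc i)) \<Longrightarrow> length (pre i v) = length (hist (Suc i) v)"
  by (simp add: pre_def hist_Suc_present)

lemma nbrs_at_pre:
  "v \<in> verts (G (Suc i)) \<Longrightarrow> nbrs_at (G 0) v (pre i v) a = neighbors (G (Suc i - a)) v"
  using nbrs_at_cong[OF map_fst_pre] nbrs_at_hist by metis

lemma new_at_pre:
  assumes "v \<in> verts (G (Suc i))"
  shows "new_at (G 0) v (pre i v) a = (if a \<le> i then newn (i - a) v else {})"
  using assms by (auto simp: new_at_def nbrs_at_pre newn_def Suc_diff_le)

lemma arrivals_pre: "v \<in> verts (G (Suc i)) \<Longrightarrow> arrivals (G 0) v (pre i v) = arrivals (G 0) v (hist (Suc i) v)"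
  by (simp add: arrivals_def map_fst_pre)

lemma born_at_pre:
  assumes "v \<in> verts (G (Suc i))" "a \<le> i"
  shows "born_at (G 0) v (pre i v) a \<longleftrightarrow> born (i - a) v"
proof -
  have "Suc a = length (hist (Suc i) v) \<longleftrightarrow>
      a < length (hist (Suc i) v) \<and> \<not> Suc a < length (hist (Suc i) v)" by auto
  also have "\<dots> \<longleftrightarrow> v \<in> verts (G (Suc (i - a))) \<and> \<not> (a < i \<and> v \<in> verts (G (i - a)))"
    using assms(2) by (simp only: age_less_length_hist) (auto simp: Suc_diff_le)
  finally show ?thesis
    using assms verts_mono[of 0 "i - a"] unfolding born_at_def born_def length_pre[OF assms(1)]
    by (cases "a = i") auto
qed

lemma received_at_hist:
  "received_at n (hist t v) a u =
     (if a < t \<and> u \<in> neighbors (G (t - a)) v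
      then message_body n (G 0) u (pre (t - Suc a) u) v else [])"
proof (cases "a < length (hist t v)")
  case True
  then have "a < t" using age_less_length_hist by blast
  then have "Suc (t - Suc a) = t - a" by simp
  then show ?thesis using True \<open>a < t\<close>
    by (simp add: received_at_def rev_hist_nth obs_def decode_message decode_Nil width_pos)
next
  case False
  then have "\<not> (a < t \<and> u \<in> neighbors (G (t - a)) v)"
    using age_less_length_hist neighbors_verts by blast
  then show ?thesis using False by (auto simp: received_at_def)
qed

lemma received_at_pre:
  assumes "a > 0"
  shows "received_at n (pre i v) a u =
     (if a \<le> i \<and> u \<in> neighbors (G (Suc i - a)) v
      then message_body n (G 0) u (pre (i - a) u) v else [])"
proof -
  obtain b where b: "a = Suc b" using assms gr0_implies_Suc by blast
  have "received_at n (pre i v) a u = received_at n (hist i v) b u"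
    by (simp add: received_at_def pre_def b)
  then show ?thesis using received_at_hist[of i v b u] b by auto
qed

lemma set_arrivals:
  assumes "v \<in> verts (G (Suc i))"
  shows "set (arrivals (G 0) v (hist (Suc i) v)) = neighbors (G (Suc i)) v"
  using assms
proof (induction i)
  case 0
  have "neighbors (G 0) v \<subseteq> neighbors (G (Suc 0)) v" by (rule neighbors_mono) simp
  then show ?case using 0
    by (auto simp: hist_Suc_present arrivals_def obs_def)
next
  case (Suc i)
  have mono: "neighbors (G (Suc i)) v \<subseteq> neighbors (G (Suc (Suc i))) v" by (rule neighbors_mono) simp
  show ?case
  proof (cases "v \<in> verts (G (Suc i))")
    case True
    then have "set (arrivals (G 0) v (hist (Suc i) v)) = neighbors (G (Suc i)) v" using Suc.IH by simp
    moreover have "hist (Suc (Suc i)) v = hist (Suc i) v @ [obs (Suc i) v]"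
      using Suc.prems hist_Suc_present by blast
    ultimately show ?thesis using mono by (auto simp: arrivals_snoc obs_def)
  next
    case False
    then have "v \<notin> verts (G 0)" using verts_mono[of 0 "Suc i"] by auto
    then have "neighbors (G 0) v = {}" using neighbors_verts by blast
    moreover have "hist (Suc (Suc i)) v = [obs (Suc i) v]"
      using Suc.prems hist_Suc_present[of v "Suc i"] False by (simp add: hist_Suc)
    ultimately show ?thesis by (simp add: arrivals_def obs_def)
  qed
qed

lemma length_arrivals:
  "v \<in> verts (G (Suc i)) \<Longrightarrow> length (arrivals (G 0) v (hist (Suc i) v)) = card (neighbors (G (Suc i)) v)"
  using distinct_card[OF distinct_arrivals] set_arrivals by metis

lemma prefix_hist:
  assumes "i \<le> j" "v \<in> verts (G i)" shows "prefix (hist i v) (hist j v)"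
  using assms(1)
proof (induction rule: dec_induct)
  case (step j)
  then have "v \<in> verts (G (Suc j))" using assms(2) verts_mono[of i "Suc j"] by auto
  then show ?case using step by (auto simp: hist_Suc_present intro: prefix_order.trans)
qed simp

lemma prefix_arrivals:
  assumes "prefix h h'" shows "prefix (arrivals G0 v h) (arrivals G0 v h')"
proof -
  obtain zs where "h' = h @ zs" using assms prefixE by blast
  moreover have "prefix (arrivals G0 v h) (arrivals G0 v (h @ zs))"
    by (induction zs rule: rev_induct)
      (auto simp flip: append_assoc simp: arrivals_snoc intro: prefix_order.trans)
  ultimately show ?thesis by simp
qed

text \<open>Lets the prefixes in \<open>listing\<close> be read as histories at earlier
  times.\<close>

lemma prefix_of_hist:
  assumes "prefix h (hist t v)" shows "\<exists>j\<le>t. h = hist j v"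
  using assms
proof (induction t)
  case (Suc t)
  show ?case
  proof (cases "v \<in> verts (G (Suc t))")
    case True
    then have "h = hist (Suc t) v \<or> prefix h (hist t v)"
      using Suc.prems by (simp add: hist_Suc_present prefix_snoc)
    then show ?thesis using Suc.IH le_Suc_eq by blast
  next
    case False
    then have "h = hist (Suc t) v" using Suc.prems by (simp add: hist_Suc)
    then show ?thesis by blast
  qed
qed simp


subsection \<open>Reports of recent changes\<close>

lemma channel_message_body:
  "channel 0 (message_body n G0 v h u) = [length h mod window n]"
  "channel 1 (message_body n G0 v h u) =
     filter (\<lambda>a. \<not> born_at G0 v h a \<and> edge_inserted_at n G0 v h a) (active_ages n G0 v h)"
  "channel 2 (message_body n G0 v h u) = filter (born_at G0 v h) (active_ages n G0 v h)"
  "channel 3 (message_body n G0 v h u) =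
     filter (\<lambda>a. \<not> born_at G0 v h a \<and> \<not> edge_inserted_at n G0 v h a) (active_ages n G0 v h)"
  "channel 4 (message_body n G0 v h u) =
     map (\<lambda>z. of_bool (bit (separator u z) (length h mod window n))) (arrivals G0 v h)"
  "channel 5 (message_body n G0 v h u) =
     map (\<lambda>p. of_bool (reply n G0 v h u p)) [0..<length (channel 4 (received_at n h 1 u))]"
  by (simp_all add: message_body_def)

lemma set_active_ages:
  assumes "v \<in> verts (G (Suc i))"
  shows "a \<in> set (active_ages n (G 0) v (pre i v)) \<longleftrightarrow> a \<le> window n \<and> a \<le> i \<and> newn (i - a) v \<noteq> {}"
  using assms by (auto simp: active_ages_def new_at_pre less_Suc_eq_le simp del: upt_Suc)

lemma set_channel_2:
  assumes "v \<in> verts (G (Suc i))"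
  shows "a \<in> set (channel 2 (message_body n (G 0) v (pre i v) u)) \<longleftrightarrow>
     a \<le> window n \<and> a \<le> i \<and> newn (i - a) v \<noteq> {} \<and> born (i - a) v"
  using assms by (auto simp: channel_message_body set_active_ages born_at_pre)

text \<open>A newborn neighbor announces age 0 on channel 2 in the very round of its birth. For
  \<open>a > 0\<close> that message has been received, which reveals the kind of change.\<close>

lemma edge_inserted_at_pre:
  assumes "v \<in> verts (G (Suc i))" "a \<le> i"
  shows "edge_inserted_at n (G 0) v (pre i v) a \<longleftrightarrow> a > 0 \<and> (\<forall>y\<in>newn (i - a) v. \<not> born (i - a) y)"
proof (cases "a > 0")
  case True
  have "0 \<in> set (channel 2 (received_at n (pre i v) a y)) \<longleftrightarrow> born (i - a) y"
    if y: "y \<in> newn (i - a) v" for y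
  proof -
    have nb: "y \<in> neighbors (G (Suc (i - a))) v" using y by (simp add: newn_def)
    then have "y \<in> verts (G (Suc (i - a)))" using neighbors_verts by blast
    moreover have "newn (i - a) y \<noteq> {}" using y newn_sym by blast
    moreover have "received_at n (pre i v) a y = message_body n (G 0) y (pre (i - a) y) v"
      using nb assms(2) True by (simp add: received_at_pre Suc_diff_le)
    ultimately show ?thesis by (simp add: set_channel_2)
  qed
  then show ?thesis using True assms by (auto simp: edge_inserted_at_def new_at_pre)
qed (simp add: edge_inserted_at_def)

lemma set_channel_1:
  assumes "v \<in> verts (G (Suc i))"
  shows "a \<in> set (channel 1 (message_body n (G 0) v (pre i v) u)) \<longleftrightarrow>
     a \<le> window n \<and> a \<le> i \<and> newn (i - a) v \<noteq> {} \<and> \<not> born (i - a) v \<and>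
     a > 0 \<and> (\<forall>y\<in>newn (i - a) v. \<not> born (i - a) y)"
  using assms unfolding channel_message_body
  by (auto simp: set_active_ages born_at_pre edge_inserted_at_pre)

lemma set_channels_123:
  assumes "v \<in> verts (G (Suc i))"
  shows "a \<in> set (channel 1 (message_body n (G 0) v (pre i v) u)) \<union>
       set (channel 2 (message_body n (G 0) v (pre i v) u)) \<union>
       set (channel 3 (message_body n (G 0) v (pre i v) u)) \<longleftrightarrow>
     a \<le> window n \<and> a \<le> i \<and> newn (i - a) v \<noteq> {}"
proof -
  have "set (channel 1 (message_body n (G 0) v (pre i v) u)) \<union>
       set (channel 2 (message_body n (G 0) v (pre i v) u)) \<union>
       set (channel 3 (message_body n (G 0) v (pre i v) u)) = set (active_ages n (G 0) v (pre i v))"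
    unfolding channel_message_body by auto
  then show ?thesis using set_active_ages[OF assms] by blast
qed

lemma simultaneous_iff:
  assumes "x \<in> neighbors (G (Suc i)) v" "y \<in> neighbors (G (Suc i)) v"
  shows "simultaneous n (hist (Suc i) v) x y \<longleftrightarrow>
    (\<exists>a. a \<le> window n \<and> a \<le> i \<and> newn (i - a) x \<noteq> {} \<and> newn (i - a) y \<noteq> {} \<and>
      (born (i - a) x \<or> a > 0 \<and> (\<forall>z\<in>newn (i - a) x. \<not> born (i - a) z)))"
proof -
  have r: "received_at n (hist (Suc i) v) 0 u = message_body n (G 0) u (pre i u) v"
    if "u \<in> neighbors (G (Suc i)) v" for u
    using that by (simp add: received_at_hist)
  have x: "x \<in> verts (G (Suc i))" and y: "y \<in> verts (G (Suc i))" using assms neighbors_verts by blast+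
  from x show ?thesis
    unfolding simultaneous_def r[OF assms(1)] r[OF assms(2)] set_channels_123[OF y]
    by (auto simp only: Un_iff set_channel_1 set_channel_2)
qed

lemma simultaneous_sound:
  assumes "x \<in> neighbors (G (Suc i)) v" "y \<in> neighbors (G (Suc i)) v" "x \<noteq> y"
    "simultaneous n (hist (Suc i) v) x y"
  shows "{x, y} \<in> edges (G (Suc i))"
proof -
  obtain a where a: "a \<le> i" "newn (i - a) x \<noteq> {}" "newn (i - a) y \<noteq> {}"
    "born (i - a) x \<or> (\<forall>z\<in>newn (i - a) x. \<not> born (i - a) z)"
    using assms simultaneous_iff by blast
  then have "x \<in> newn (i - a) y"
    using born_newn_adjacent[of "i - a" x y] edge_newn_adjacent[of "i - a" x y] assms(3) by blast
  then show ?thesis using newn_edges by simp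
qed

text \<open>An old neighbor of a newborn node reports that round on channel 3 only, so a newborn end
  must be the first argument; hence the disjunction. At age 0 an edge insertion is not yet
  recognized.\<close>

lemma simultaneous_recent_edge:
  assumes "x \<in> neighbors (G (Suc i)) v" "y \<in> neighbors (G (Suc i)) v"
    "x \<in> newn (i - a) y" "a \<le> i" "a \<le> window n" "a > 0"
  shows "simultaneous n (hist (Suc i) v) x y \<or> simultaneous n (hist (Suc i) v) y x"
proof -
  have "newn (i - a) x \<noteq> {}" "newn (i - a) y \<noteq> {}" using assms(3) newn_sym by blast+
  moreover have "newn (i - a) x = {y}" if "\<not> born (i - a) x" "\<not> born (i - a) y"
    using newn_edge that assms(3) by blast
  ultimately show ?thesis
    unfolding simultaneous_iff[OF assms(1,2)] simultaneous_iff[OF assms(2,1)]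
    using assms by (cases "born (i - a) x"; cases "born (i - a) y") auto
qed

text \<open>Covers births at age 0: a newborn node knows its own birth at once.\<close>

lemma simultaneous_born:
  assumes "x \<in> neighbors (G (Suc i)) v" "y \<in> neighbors (G (Suc i)) v" "x \<in> newn i y" "born i x"
  shows "simultaneous n (hist (Suc i) v) x y"
proof -
  have "newn i x \<noteq> {}" "newn i y \<noteq> {}" using assms(3) newn_sym by blast+
  then show ?thesis unfolding simultaneous_iff[OF assms(1,2)] using assms(4)
    by (intro exI[of _ 0]) auto
qed


subsection \<open>Confirmation by separating bits\<close>

lemma id_less: "v \<in> verts (G i) \<Longrightarrow> v < 2 ^ id_bits n"
proof -
  assume "v \<in> verts (G i)"
  then have "v \<le> n" using verts_le[of i] by auto
  then show ?thesis using less_two_power_bit_length[of n] by (simp add: id_bits_def)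
qed

lemma id_bits_less: "id_bits n < 2 ^ window n"
  using less_two_power_bit_length[of "id_bits n"] by (simp add: window_def)

text \<open>At ages 1 to \<open>window n\<close>, \<open>w\<close> has sent \<open>x\<close> bits of
  \<open>separator x y\<close> at the fixed position \<open>p\<close>, with indices running through
  all residues modulo \<open>window n\<close>. This leaves the separator as the only candidate for
  \<open>q\<close> in \<open>reply\<close>.\<close>

lemma reply_iff:
  assumes xy: "x \<noteq> y" and win: "window n \<le> i"
    and nb: "\<And>a. a \<le> window n \<Longrightarrow> {x, y} \<subseteq> neighbors (G (Suc i - a)) w"
    and p: "p < length (arrivals (G 0) w (hist (Suc i) w))" "arrivals (G 0) w (hist (Suc i) w) ! p = y"
  shows "channel 5 (received_at n (hist (Suc i) w) 0 x) ! p = 1 \<longleftrightarrow>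
    newn i x \<noteq> {} \<and> (\<forall>z\<in>newn i x. bit z (separator x y) \<noteq> bit x (separator x y))"
proof -
  let ?T = "window n" and ?q = "separator x y" and ?len = "length (hist (Suc i) w)"
  let ?h = "pre i x"
  have w: "w \<in> verts (G (Suc i - a))" and x: "x \<in> verts (G (Suc i - a))" and y: "y \<in> verts (G (Suc i - a))"
    and wx: "w \<in> neighbors (G (Suc i - a)) x"
    if "a \<le> ?T" for a using nb[OF that] neighbors_verts neighbors_sym by blast+
  have x0: "x \<in> verts (G (Suc i))" using x[of 0] by simp
  \<comment> \<open>Later arrival lists extend earlier ones and have distinct entries, so
    \<open>y\<close> was at position \<open>p\<close> throughout the window.\<close>
  have pT: "p < length (arrivals (G 0) w (hist (Suc (i - a)) w))"
    and py: "arrivals (G 0) w (hist (Suc (i - a)) w) ! p = y" if a: "a \<le> ?T" for a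
  proof -
    let ?l = "arrivals (G 0) w (hist (Suc (i - a)) w)" and ?l' = "arrivals (G 0) w (hist (Suc i) w)"
    have e: "Suc (i - a) = Suc i - a" using a win by (auto simp: Suc_diff_le)
    have pre: "prefix ?l ?l'"
      by (rule prefix_arrivals, rule prefix_hist) (use w[OF a] e in auto)
    have "y \<in> set ?l" using set_arrivals[of w "i - a"] w[OF a] nb[OF a] e by auto
    then obtain p' where p': "p' < length ?l" "?l ! p' = y" by (auto simp: in_set_conv_nth)
    with pre have "p' < length ?l'" "?l' ! p' = y" by (auto simp: prefix_def nth_append)
    then have "p' = p" using p distinct_arrivals nth_eq_iff_index_eq by metis
    with p' show "p < length ?l" "?l ! p = y" by auto
  qed
  have len_gt: "?T < ?len" using win w[OF order_refl] by (simp add: age_less_length_hist)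
  have received: "received_at n ?h a w = message_body n (G 0) w (pre (i - a) w) x"
    if "a \<in> {1..?T}" for a
    using that win wx[of a] by (simp add: received_at_pre)
  \<comment> \<open>The history of \<open>w\<close> grows by one per round, so the indices of the
    transmitted bits are consecutive modulo \<open>?T\<close>.\<close>
  have len: "length (pre (i - a) w) = ?len - a" if a: "a \<le> ?T" for a
  proof -
    have e: "Suc (i - a) = Suc i - a" using a win by (auto simp: Suc_diff_le)
    have "length (hist (Suc (i - b)) w) + b = ?len" if "b \<le> ?T" for b
      using that
    proof (induction b)
      case (Suc b)
      then have "Suc (i - Suc b) = i - b" using win by simp
      moreover have "Suc (i - b) = Suc i - b" using Suc win by simp
      moreover have "w \<in> verts (G (Suc i - b))" using w Suc.prems by simp
      ultimately show ?case using Suc hist_Suc_present[of w "i - b"] by simp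
    qed simp
    from this[OF a] show ?thesis using length_pre[of w "i - a"] w[OF a] e by simp
  qed
  have chan0: "hd (channel 0 (received_at n ?h a w)) = (?len - a) mod ?T" if "a \<in> {1..?T}" for a
    using that by (simp add: received channel_message_body len)
  have chan4: "channel 4 (received_at n ?h a w) ! p = of_bool (bit ?q ((?len - a) mod ?T))"
    if a: "a \<in> {1..?T}" for a
  proof -
    have e: "Suc (i - a) = Suc i - a" using a win by (auto simp: Suc_diff_le)
    have "arrivals (G 0) w (pre (i - a) w) = arrivals (G 0) w (hist (Suc (i - a)) w)"
      using arrivals_pre[of w "i - a"] w[of a] a e by simp
    then show ?thesis using a pT[of a] py[of a] by (simp add: received channel_message_body len)
  qed
  have agree: "(channel 4 (received_at n ?h a w) ! p = 1) = bit q (hd (channel 0 (received_at n ?h a w))) \<longleftrightarrow>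
      bit ?q ((?len - a) mod ?T) = bit q ((?len - a) mod ?T)" if "a \<in> {1..?T}" for a q
    unfolding chan0[OF that] chan4[OF that] by simp
  have q_less: "?q < id_bits n"
    using separator_less[OF xy] id_less x[of 0] y[of 0] by simp
  have unique: "q = ?q"
    if "q < id_bits n"
      and "\<forall>a\<in>{1..?T}. bit ?q ((?len - a) mod ?T) = bit q ((?len - a) mod ?T)" for q
  proof (rule eq_if_bits_eq[of _ ?T])
    show "q < 2 ^ ?T" "?q < 2 ^ ?T" using that(1) q_less id_bits_less by linarith+
    fix k assume k: "k < ?T"
    \<comment> \<open>\<open>?a\<close> is the age at which bit \<open>k\<close> was sent; taking 1
      off before the reduction and adding it back places \<open>?a\<close> in 1 to \<open>?T\<close>
      rather than 0 to \<open>?T - 1\<close>.\<close>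
    let ?m = "?len - 1 - k"
    let ?a = "Suc (?m mod ?T)"
    have "?a \<in> {1..?T}" using window_pos[of n] by (simp add: Suc_leI)
    moreover have "(?len - ?a) mod ?T = k"
    proof -
      have "?m mod ?T \<le> ?m" by simp
      then have "?len - ?a = k + (?m - ?m mod ?T)" using k len_gt by linarith
      also have "?m - ?m mod ?T = ?T * (?m div ?T)" by (rule minus_mod_eq_mult_div)
      finally show ?thesis using k by simp
    qed
    ultimately show "bit q k = bit ?q k" using that(2) by metis
  qed
  have new: "new_at (G 0) x ?h 0 = newn i x" using new_at_pre[OF x0, of 0] by simp
  have "reply n (G 0) x ?h w p \<longleftrightarrow> newn i x \<noteq> {} \<and>
     (\<exists>q<id_bits n. (\<forall>a\<in>{1..?T}. bit ?q ((?len - a) mod ?T) = bit q ((?len - a) mod ?T)) \<and>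
        (\<forall>z\<in>newn i x. bit z q \<noteq> bit x q))"
    unfolding reply_def new by (simp only: agree cong: ball_cong)
  also have "\<dots> \<longleftrightarrow> newn i x \<noteq> {} \<and> (\<forall>z\<in>newn i x. bit z ?q \<noteq> bit x ?q)"
    using unique q_less by blast
  finally have iff: "reply n (G 0) x ?h w p \<longleftrightarrow>
      newn i x \<noteq> {} \<and> (\<forall>z\<in>newn i x. bit z ?q \<noteq> bit x ?q)" .
  \<comment> \<open>Replies refer to the positions in the previous message of \<open>w\<close>;
    \<open>p\<close> was among them, so the list access is in range.\<close>
  have "p < length (channel 4 (received_at n ?h 1 w))"
  proof -
    have "1 \<le> ?T" using window_pos[of n] by simp
    then show ?thesis
      using pT[of 1] received[of 1] arrivals_pre[of w "i - 1"] w[of 1] win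
      by (simp add: channel_message_body)
  qed
  moreover have "received_at n (hist (Suc i) w) 0 x = message_body n (G 0) x ?h w"
    using nb[of 0] by (simp add: received_at_hist)
  ultimately show ?thesis using iff by (simp add: channel_message_body)
qed


lemma confirms_iff:
  assumes "x \<noteq> y" "window n \<le> i" "\<And>a. a \<le> window n \<Longrightarrow> {x, y} \<subseteq> neighbors (G (Suc i - a)) w"
  shows "confirms n (G 0) w (hist (Suc i) w) x y \<longleftrightarrow>
    newn i x \<noteq> {} \<and> (\<forall>z\<in>newn i x. bit z (separator x y) \<noteq> bit x (separator x y))"
proof -
  have "y \<in> neighbors (G (Suc i)) w" using assms(3)[of 0] by simp
  then have "y \<in> set (arrivals (G 0) w (hist (Suc i) w))" using set_arrivals neighbors_verts by blast
  then show ?thesis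
    unfolding confirms_def using reply_iff[OF assms(1,2,3)] by (auto simp: in_set_conv_nth)
qed


subsection \<open>Correctness\<close>

lemma detects_sound:
  assumes nb: "{x, y} \<subseteq> neighbors (G t) v" and xy: "x \<noteq> y" and d: "detects n (G 0) v (hist t v) x y"
  shows "{x, y} \<in> edges (G t)"
proof (cases t)
  case 0
  then show ?thesis using d by (simp add: detects_def simultaneous_def received_at_def)
next
  case (Suc i)
  have "{x, y} \<in> edges (G t)" if "{x, y} \<in> edges (G 0)" using that edges_mono[of 0 t] by auto
  moreover have "{x, y} \<in> edges (G t)" if "simultaneous n (hist t v) x y"
    using simultaneous_sound[of x i v y] that nb xy Suc by simp
  moreover have "{x, y} \<in> edges (G t)"
    if "window n < length (hist t v)" and conf: "confirms n (G 0) v (hist t v) x y"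
        "confirms n (G 0) v (hist t v) y x"
      and nbs: "\<forall>a\<le>window n. {x, y} \<subseteq> nbrs_at (G 0) v (hist t v) a"
  proof -
    let ?q = "separator x y"
    have win: "window n \<le> i" using that(1) Suc age_less_length_hist by auto
    have nb': "{x, y} \<subseteq> neighbors (G (Suc i - a)) v" if "a \<le> window n" for a
      using nbs that Suc by (simp add: nbrs_at_hist)
    \<comment> \<open>Age 1 lies in the window, so both nodes were present before this
      round.\<close>
    have "\<not> born i x" "\<not> born i y"
      using nb'[of 1] window_pos[of n] neighbors_verts[of _ i v] by (auto simp: born_def Suc_le_eq)
    moreover have "newn i x \<noteq> {}" "\<forall>z\<in>newn i x. bit z ?q \<noteq> bit x ?q"
      using conf(1) confirms_iff[OF xy win nb'] Suc by auto
    moreover have "newn i y \<noteq> {}" "\<forall>z\<in>newn i y. bit z ?q \<noteq> bit y ?q"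
      using conf(2) confirms_iff[of y x i v] xy win nb' Suc
      by (auto simp: separator_commute[of y x] insert_commute)
    \<comment> \<open>A common new neighbor would differ at \<open>?q\<close> from both
      \<open>x\<close> and \<open>y\<close>, which differ from each other there; no bit can do
      that.\<close>
    ultimately have "x \<in> newn i y"
      using newn_same_or_adjacent[of i x y] bit_separator[OF xy] xy by blast
    then show ?thesis using newn_edges Suc by simp
  qed
  ultimately show ?thesis using d unfolding detects_def by blast
qed

lemma triangle_listed:
  assumes "{x, y} \<subseteq> neighbors (G t) v" "x \<noteq> y" "detects n (G 0) v (hist t v) x y"
  shows "triangle v x y \<in> list_now n v (G 0) (hist t v)"
  using assms by (auto simp: list_now_def nbrs_at_hist)

section \<open>Completeness of the detection\<close>

lemma edge_inserted:
  assumes "{x, y} \<in> edges (G i)" "{x, y} \<notin> edges (G 0)"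
  obtains j where "j < i" "x \<in> newn j y"
proof -
  have "\<exists>j<i. {x, y} \<notin> edges (G j) \<and> {x, y} \<in> edges (G (Suc j))"
    using assms
  proof (induction i)
    case (Suc i)
    then show ?case by (cases "{x, y} \<in> edges (G i)") (auto intro: less_SucI)
  qed simp
  then show ?thesis using that by (auto simp: newn_def neighbors_iff)
qed

lemma triangle_rotate: "triangle x y z = triangle y z x"
  by (auto simp: triangle_def insert_commute)

lemma triangle_swap: "triangle x y z = triangle x z y"
  by (auto simp: triangle_def insert_commute)

text \<open>If \<open>x\<close> or \<open>y\<close> is newborn, \<open>z\<close> lists the triangle.
  Otherwise, if an edge at \<open>z\<close> is initial or recent, the vertex opposite to that edge
  does; if both edges are old, \<open>z\<close> does, by confirmation.\<close>

lemma new_triangle_listed: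
  assumes new: "x \<in> newn i y"
    and xz: "{x, z} \<in> edges (G (Suc i))" and yz: "{y, z} \<in> edges (G (Suc i))"
  shows "\<exists>v\<in>{x, y, z}. triangle x y z \<in> list_now n v (G 0) (hist (Suc i) v)"
proof -
  have xy: "{x, y} \<in> edges (G (Suc i))" using new newn_edges by blast
  then have ne: "x \<noteq> y" "x \<noteq> z" "y \<noteq> z" using edge_verts xz yz by blast+
  have nb: "{x, y} \<subseteq> neighbors (G (Suc i)) z" "{x, z} \<subseteq> neighbors (G (Suc i)) y"
    "{y, z} \<subseteq> neighbors (G (Suc i)) x"
    using xy xz yz by (auto simp: neighbors_iff insert_commute)
  note listed = triangle_listed[OF nb(1) ne(1)] triangle_listed[OF nb(2) ne(2)]
    triangle_listed[OF nb(3) ne(3)]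
  have rot: "triangle z x y = triangle x y z" "triangle y x z = triangle x y z"
    by (metis triangle_rotate, metis triangle_rotate triangle_swap)
  have sym: "triangle x y z \<in> list_now n v (G 0) (hist (Suc i) v)"
    if "simultaneous n (hist (Suc i) v) a b \<or> simultaneous n (hist (Suc i) v) b a"
      "{a, b} \<subseteq> neighbors (G (Suc i)) v" "a \<noteq> b" "triangle v a b = triangle x y z" for v a b
    using triangle_listed[of a b "Suc i" v] triangle_listed[of b a "Suc i" v] that
    by (auto simp: detects_def triangle_swap[of v b a])
  show ?thesis
  proof (cases "born i x \<or> born i y")
    case True
    then have "simultaneous n (hist (Suc i) z) x y \<or> simultaneous n (hist (Suc i) z) y x"
      using simultaneous_born nb(1) new newn_sym by (metis insert_subset)
    then show ?thesis using sym nb(1) ne rot by blast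
  next
    case False
    then have nx: "newn i x = {y}" and ny: "newn i y = {x}" using newn_edge new newn_sym by blast+
    have "z \<notin> newn i x" "z \<notin> newn i y" using nx ny ne by auto
    then have xz': "{x, z} \<in> edges (G i)" and yz': "{y, z} \<in> edges (G i)"
      using xz yz by (auto simp: newn_def neighbors_iff insert_commute)
    consider "{x, z} \<in> edges (G 0)" | "{y, z} \<in> edges (G 0)"
      | "{x, z} \<notin> edges (G 0)" "{y, z} \<notin> edges (G 0)" by blast
    then show ?thesis
    proof cases
      case 1
      then show ?thesis using listed(2) rot by (auto simp: detects_def)
    next
      case 2
      then show ?thesis using listed(3) by (auto simp: detects_def)
    next
      case 3
      obtain j where j: "j < i" "x \<in> newn j z" using edge_inserted xz' 3(1) by blast
      obtain k where k: "k < i" "y \<in> newn k z" using edge_inserted yz' 3(2) by blast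
      consider "i - j \<le> window n" | "i - k \<le> window n" | "i - j > window n" "i - k > window n"
        by linarith
      then show ?thesis
      proof cases
        case 1
        then have "simultaneous n (hist (Suc i) y) x z \<or> simultaneous n (hist (Suc i) y) z x"
          using simultaneous_recent_edge[of x i y z "i - j"] nb(2) j by simp
        then show ?thesis using sym nb(2) ne rot by blast
      next
        case 2
        then have "simultaneous n (hist (Suc i) x) y z \<or> simultaneous n (hist (Suc i) x) z y"
          using simultaneous_recent_edge[of y i x z "i - k"] nb(3) k by simp
        then show ?thesis using sym nb(3) ne by blast
      next
        case 3
        \<comment> \<open>Both edges at \<open>z\<close> are older than the window, so they exist
          throughout it.\<close>
        have nbz: "{x, y} \<subseteq> neighbors (G (Suc i - a)) z" if "a \<le> window n" for a
        proof -
          have "Suc j \<le> Suc i - a" "Suc k \<le> Suc i - a" using 3 that by linarith+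
          then show ?thesis using neighbors_mono j(2) k(2) by (force simp: newn_def)
        qed
        have win: "window n \<le> i" using 3 by simp
        have "z \<in> verts (G (Suc i - window n))"
          using nbz[OF order_refl] neighbors_verts by blast
        then have "window n < length (hist (Suc i) z)" using win by (simp add: age_less_length_hist)
        moreover have "confirms n (G 0) z (hist (Suc i) z) x y"
          using confirms_iff[OF ne(1) win nbz] nx bit_separator[OF ne(1)] by auto
        moreover have "confirms n (G 0) z (hist (Suc i) z) y x"
          using confirms_iff[of y x i z] nbz ne(1) win ny bit_separator[of y x] by auto
        ultimately have "detects n (G 0) z (hist (Suc i) z) x y"
          using nbz by (simp add: detects_def nbrs_at_hist)
        then show ?thesis using listed(1) rot by auto
      qed
    qed
  qed
qed

lemma triangle_listed_sometime:
  assumes "{x, y} \<in> edges (G t)" "{x, z} \<in> edges (G t)" "{y, z} \<in> edges (G t)"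
  shows "\<exists>v j. j \<le> t \<and> v \<in> verts (G j) \<and> triangle x y z \<in> list_now n v (G 0) (hist j v)"
  using assms
proof (induction t)
  case 0
  \<comment> \<open>Time 0 is the empty history, at which any vertex recognizes the opposite edge as
    initial.\<close>
  then have "triangle x y z \<in> list_now n x (G 0) (hist 0 x)"
    using edge_verts[of y z 0]
    by (intro triangle_listed) (auto simp: neighbors_iff detects_def insert_commute)
  then show ?case using 0 edge_verts by blast
next
  case (Suc i)
  have in_verts: "x \<in> verts (G (Suc i))" "y \<in> verts (G (Suc i))" "z \<in> verts (G (Suc i))"
    using Suc.prems edge_verts by blast+
  have new: "u \<in> newn i v \<or> {u, v} \<in> edges (G i)" if "{u, v} \<in> edges (G (Suc i))" for u v
    using that by (auto simp: newn_def neighbors_iff)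
  consider "x \<in> newn i y" | "x \<in> newn i z" | "y \<in> newn i z"
    | "{x, y} \<in> edges (G i)" "{x, z} \<in> edges (G i)" "{y, z} \<in> edges (G i)"
    using new Suc.prems by blast
  then show ?case
  proof cases
    case 1
    then show ?thesis using new_triangle_listed[of x i y z] Suc.prems in_verts by blast
  next
    case 2
    then show ?thesis using new_triangle_listed[of x i z y] Suc.prems in_verts
      by (auto simp: insert_commute triangle_swap[of x z y])
  next
    case 3
    then show ?thesis using new_triangle_listed[of y i z x] Suc.prems in_verts
      by (auto simp: insert_commute triangle_rotate[of x y z])
  next
    case 4
    then show ?thesis using Suc.IH le_SucI by blast
  qed
qed

section \<open>Copies of the complete graph on three nodes, and correctness of the lists\<close>

lemma edges_complete_graph_3:
  "edges (complete_graph 3) = {{1, 2}, {1, 3}, {2, 3}}" (is "?E = ?E'")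
proof
  show "?E \<subseteq> ?E'"
    unfolding complete_graph_def by (auto simp: numeral_3_eq_3 numeral_2_eq_2 le_Suc_eq)
  show "?E' \<subseteq> ?E" unfolding complete_graph_def by fastforce
qed

lemma copies_K3:
  "copies (complete_graph 3) (G t) =
     {triangle x y z | x y z. {x, y} \<in> edges (G t) \<and> {x, z} \<in> edges (G t) \<and> {y, z} \<in> edges (G t)}"
  (is "?L = ?R")
proof (intro set_eqI iffI)
  have K3: "verts (complete_graph 3) = {1, 2, 3}"
    unfolding complete_graph_def by auto
  {
    fix S assume "S \<in> ?L"
    then obtain f where f: "bij_betw f {1, 2, 3} (verts S)"
      "edges S = (\<lambda>e. f ` e) ` {{1, 2}, {1, 3}, {2, 3::nat}}" "edges S \<subseteq> edges (G t)"
      unfolding copies_def isomorphic_def subgraph_def K3 edges_complete_graph_3 by blast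
    have "verts S = {f 1, f 2, f 3}" using f(1) by (auto simp: bij_betw_def)
    moreover have "edges S = {{f 1, f 2}, {f 1, f 3}, {f 2, f 3}}" using f(2) by simp
    ultimately have "S = triangle (f 1) (f 2) (f 3)" by (simp add: triangle_def)
    moreover from this have "{f 1, f 2} \<in> edges (G t)" "{f 1, f 3} \<in> edges (G t)" "{f 2, f 3} \<in> edges (G t)"
      using f(3) by (auto simp: triangle_def)
    ultimately show "S \<in> ?R" by blast
  next
    fix S assume "S \<in> ?R"
    then obtain x y z where S: "S = triangle x y z"
      and e: "{x, y} \<in> edges (G t)" "{x, z} \<in> edges (G t)" "{y, z} \<in> edges (G t)" by blast
    then have v: "x \<in> verts (G t)" "y \<in> verts (G t)" "z \<in> verts (G t)"
      and ne: "x \<noteq> y" "x \<noteq> z" "y \<noteq> z" using edge_verts by blast+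
    let ?f = "\<lambda>k::nat. if k = 1 then x else if k = 2 then y else z"
    have "bij_betw ?f {1, 2, 3} (verts S)"
      using ne S by (auto simp: bij_betw_def inj_on_def triangle_def)
    moreover have "edges S = (\<lambda>e. ?f ` e) ` edges (complete_graph 3)"
      unfolding S triangle_def edges_complete_graph_3 by (simp add: insert_commute)
    ultimately have "isomorphic (complete_graph 3) S" unfolding isomorphic_def K3 by blast
    moreover have "subgraph S (G t)"
      using e v ne unfolding subgraph_def simple_graph_def S triangle_def by auto
    ultimately show "S \<in> ?L" by (simp add: copies_def)
  }
qed

text \<open>Edges are never removed, so triangles listed earlier stay correct; as histories only
  grow, it suffices that each triangle was listed at some time.\<close>

lemma lists_triangles: "lists_in_one_round (complete_graph 3) triangle_algorithm n G"
  unfolding lists_in_one_round_def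
proof (intro allI equalityI subsetI)
  fix i S
  assume "S \<in> (\<Union>v\<in>verts (G (Suc i)). listing triangle_algorithm n v (G 0) (hist (Suc i) v))"
  then obtain v h where "prefix h (hist (Suc i) v)" and S: "S \<in> list_now n v (G 0) h"
    by (auto simp: listing_triangle_algorithm)
  then obtain j where j: "j \<le> Suc i" "h = hist j v" using prefix_of_hist by blast
  obtain x y where xy: "S = triangle v x y" "{x, y} \<subseteq> neighbors (G j) v" "x \<noteq> y"
    "detects n (G 0) v h x y"
    using S unfolding list_now_def j(2) nbrs_at_hist by auto
  have "{x, y} \<in> edges (G j)"
    using detects_sound[of x y j v] xy(2,3,4) j(2) by blast
  moreover have "{v, x} \<in> edges (G j)" "{v, y} \<in> edges (G j)"
    using xy(2) by (simp_all add: neighbors_iff insert_commute)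
  ultimately have "{x, y} \<in> edges (G (Suc i))" "{v, x} \<in> edges (G (Suc i))" "{v, y} \<in> edges (G (Suc i))"
    using edges_mono[OF j(1)] by auto
  then show "S \<in> copies (complete_graph 3) (G (Suc i))" unfolding copies_K3 using xy(1) by blast
next
  fix i S assume "S \<in> copies (complete_graph 3) (G (Suc i))"
  then obtain v j where j: "j \<le> Suc i" "v \<in> verts (G j)" and S: "S \<in> list_now n v (G 0) (hist j v)"
    unfolding copies_K3 using triangle_listed_sometime by blast
  have "v \<in> verts (G (Suc i))" using j verts_mono by blast
  then show "S \<in> (\<Union>v\<in>verts (G (Suc i)). listing triangle_algorithm n v (G 0) (hist (Suc i) v))"
    using S prefix_hist[OF j] unfolding listing_triangle_algorithm by blast
qed


subsection \<open>Bandwidth\<close>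

lemma card_neighbors_le:
  assumes "v \<in> verts (G i)" shows "card (neighbors (G i) v) \<le> max_degree G"
  unfolding max_degree_def
proof (rule cSup_upper)
  show "bdd_above {card (neighbors (G i) v) | i v. v \<in> verts (G i)}"
    by (rule bdd_aboveI[of _ n]) (use card_mono[OF _ neighbors_subset] in fastforce)
qed (use assms in blast)

text \<open>Each strict decrease costs an element. For neighbor sets at growing ages, this bounds
  the number of reported ages by the degree, however long the window.\<close>

lemma number_of_strict_steps:
  fixes f :: "nat \<Rightarrow> 'a set"
  assumes "\<And>a. f (Suc a) \<subseteq> f a" "finite (f 0)"
  shows "length (filter (\<lambda>a. f a - f (Suc a) \<noteq> {}) [0..<m]) + card (f m) \<le> card (f 0)"
proof (induction m)
  case (Suc m)
  have "finite (f m)" using assms by (induction m) (auto intro: finite_subset)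
  moreover have "f (Suc m) \<subset> f m" if "f m - f (Suc m) \<noteq> {}" using that assms(1) by blast
  ultimately have "card (f (Suc m)) \<le> card (f m)"
    "f m - f (Suc m) \<noteq> {} \<Longrightarrow> card (f (Suc m)) < card (f m)"
    using assms(1) by (auto intro: card_mono psubset_card_mono)
  then show ?case using Suc by (cases "f m - f (Suc m) = {}") simp_all
qed simp

text \<open>Four groups of at most \<open>max_degree G\<close> entries: the bit index, the ages on
  channels 1 to 3 together, the separator bits and the replies.\<close>

lemma within_bandwidth_triangles:
  "within_bandwidth triangle_algorithm n G (4 * max_degree G * width n)"
  unfolding within_bandwidth_def
proof (intro allI ballI)
  fix i u v assume u: "u \<in> verts (G (Suc i))" and v: "v \<in> neighbors (G (Suc i)) u"
  let ?D = "max_degree G" and ?h = "pre i u"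
  have deg: "card (neighbors (G (Suc i)) u) \<le> ?D" using card_neighbors_le u by blast
  \<comment> \<open>The recipient is a neighbor, so the degree is at least 1 and absorbs the single
    entry of channel 0.\<close>
  moreover have "0 < card (neighbors (G (Suc i)) u)" using v by (auto simp: card_gt_0_iff)
  ultimately have D: "1 \<le> ?D" by linarith
  have arr: "length (arrivals (G 0) u ?h) \<le> ?D"
    using arrivals_pre[OF u] length_arrivals[OF u] deg by simp
  have "length (active_ages n (G 0) u ?h) \<le> card (nbrs_at (G 0) u ?h 0)"
  proof -
    have "nbrs_at (G 0) u ?h (Suc a) \<subseteq> nbrs_at (G 0) u ?h a" for a
      using u by (simp only: nbrs_at_pre) (rule neighbors_mono, simp)
    from number_of_strict_steps[of "nbrs_at (G 0) u ?h", OF this, of "Suc (window n)"]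
    show ?thesis using u by (simp add: active_ages_def new_at_def nbrs_at_pre del: upt_Suc)
  qed
  then have act: "length (active_ages n (G 0) u ?h) \<le> ?D" using deg u by (simp add: nbrs_at_pre)
  \<comment> \<open>There are as many replies as \<open>v\<close> had neighbors one round
    earlier.\<close>
  have rep: "length (channel 4 (received_at n ?h 1 v)) \<le> ?D"
  proof (cases "1 \<le> i \<and> v \<in> neighbors (G i) u")
    case True
    then have "v \<in> verts (G i)" using neighbors_verts by blast
    moreover obtain k where "i = Suc k" using True by (cases i) auto
    ultimately show ?thesis using True
      by (simp add: received_at_pre channel_message_body arrivals_pre length_arrivals card_neighbors_le)
  qed (auto simp: received_at_pre)
  have filters: "length (filter (\<lambda>a. \<not> P a \<and> Q a) xs) + (length (filter P xs) +
      length (filter (\<lambda>a. \<not> P a \<and> \<not> Q a) xs)) = length xs" for P Q and xs :: "nat list"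
    by (induction xs) auto
  have "length (message_body n (G 0) u ?h v) =
      1 + length (active_ages n (G 0) u ?h) + length (arrivals (G 0) u ?h) +
      length (channel 4 (received_at n ?h 1 v))"
    using filters[of "born_at (G 0) u ?h" "edge_inserted_at n (G 0) u ?h" "active_ages n (G 0) u ?h"]
    by (simp add: message_body_def)
  also have "\<dots> \<le> 4 * ?D" using D arr act rep by linarith
  finally have "length (message_body n (G 0) u ?h v) \<le> 4 * ?D" .
  moreover have "message triangle_algorithm n G i u v = encode (width n) (message_body n (G 0) u ?h v)"
    by (simp add: message_def send_triangle_algorithm pre_def)
  ultimately show "length (message triangle_algorithm n G i u v) \<le> 4 * ?D * width n"
    by (simp add: length_encode mult.commute)
qed

end

section \<open>Asymptotics of the entry width\<close>

lemma width_bigo: "(\<lambda>n. real (width n)) \<in> O(\<lambda>n. log 2 (log 2 (log 2 (real n))))"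
proof -
  \<comment> \<open>Unfolds the three nested bit lengths, each exceeding its logarithm by at most 1,
    into a majorant without rounding.\<close>
  let ?f = "\<lambda>n. log 2 (6 * (log 2 (log 2 (real n + 1) + 2) + 2) + 7) + 2"
  have "real (width n) \<le> ?f n" for n
  proof -
    have L: "real (id_bits n) + 1 \<le> log 2 (real n + 1) + 2"
      using bit_length_le[of n] by (simp add: id_bits_def)
    have "real (window n) \<le> log 2 (real (id_bits n) + 1) + 2"
      using bit_length_le[of "id_bits n"] by (simp add: window_def)
    also have "\<dots> \<le> log 2 (log 2 (real n + 1) + 2) + 2" using L by simp
    finally have T: "real (window n) \<le> log 2 (log 2 (real n + 1) + 2) + 2" .
    have "real (width n) \<le> log 2 (6 * real (window n) + 7) + 2"
      using bit_length_le[of "6 * window n + 6"] by (simp add: width_def add.commute)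
    also have "log 2 (6 * real (window n) + 7) \<le> log 2 (6 * (log 2 (log 2 (real n + 1) + 2) + 2) + 7)"
      using T by (intro log_mono) auto
    finally show ?thesis by simp
  qed
  then have "(\<lambda>n. real (width n)) \<in> O(?f)"
    by (intro bigoI[of _ 1] always_eventually) (auto intro: order_trans[OF _ abs_ge_self])
  also have "?f \<in> O(\<lambda>n. log 2 (log 2 (log 2 (real n))))" by real_asymp
  finally show ?thesis .
qed

theorem theorem1p7:
  "\<exists>(A :: algorithm) (B :: nat \<Rightarrow> nat \<Rightarrow> nat).
     (\<forall>n G. dynamic_network n G \<longrightarrow>
        lists_in_one_round (complete_graph 3) A n G \<and>
        within_bandwidth A n G (B n (max_degree G))) \<and>
     (\<lambda>(n, \<Delta>). real (B n \<Delta>)) \<in>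
       O[at_top \<times>\<^sub>F top](\<lambda>(n, \<Delta>). real \<Delta> * log 2 (log 2 (log 2 (real n))))"
proof (intro exI conjI allI impI)
  fix n G assume "dynamic_network n G"
  then interpret network n G by unfold_locales
  show "lists_in_one_round (complete_graph 3) triangle_algorithm n G" by (rule lists_triangles)
  show "within_bandwidth triangle_algorithm n G ((\<lambda>n \<Delta>. 4 * \<Delta> * width n) n (max_degree G))"
    using within_bandwidth_triangles by simp
next
  obtain c where "\<forall>\<^sub>F n in at_top. norm (real (width n)) \<le> c * norm (log 2 (log 2 (log 2 (real n))))"
    using landau_o.bigE[OF width_bigo] by blast
  \<comment> \<open>The bound is free of \<Delta>, so it holds eventually in \<open>n\<close> for
    all \<Delta> at once, as the filter \<open>top\<close> demands.\<close>
  then have "\<forall>\<^sub>F (n, \<Delta>) in at_top \<times>\<^sub>F top.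
      norm (real (width n)) \<le> c * norm (log 2 (log 2 (log 2 (real n))))"
    by (subst eventually_prod1) (auto simp: trivial_limit_def eventually_top)
  then have "\<forall>\<^sub>F p in at_top \<times>\<^sub>F top. norm (case p of (n, \<Delta>) \<Rightarrow> real (4 * \<Delta> * width n)) \<le>
      4 * c * norm (case p of (n, \<Delta>) \<Rightarrow> real \<Delta> * log 2 (log 2 (log 2 (real n))))"
  proof eventually_elim
    case (elim p)
    obtain n d where p: "p = (n, d)" by force
    have "real d * norm (real (width n)) \<le> real d * (c * norm (log 2 (log 2 (log 2 (real n)))))"
      using elim p by (intro mult_left_mono) auto
    then show ?case by (simp add: p abs_mult algebra_simps)
  qed
  then show "(\<lambda>(n, \<Delta>). real ((\<lambda>n \<Delta>. 4 * \<Delta> * width n) n \<Delta>)) \<in>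
      O[at_top \<times>\<^sub>F top](\<lambda>(n, \<Delta>). real \<Delta> * log 2 (log 2 (log 2 (real n))))"
    by (intro bigoI) simp
qed

end
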